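(* Let $0<L\le U$, $\theta=U/L$, $\delta\in[0,1]$, and let $\alpha_\delta^{\theta,*}$ be the optimal $\mathrm{CVaR}_\delta$-competitive ratio for one-max search. Let $\underline r(\delta)$ be the unique positive solution of $$(\underline r(\delta)-1)\left(1+\frac{\underline r(\delta)}{\underline n(\delta)}\right)^{\underline n(\delta)}=\theta-1,\qquad\underline n(\delta)=\max\{1,\lceil\delta^{-1}\rceil-1\},$$ with the case $\delta=0$ defined by the limit $\delta\downarrow0$ (i.e. $(\underline r(0)-1)e^{\underline r(0)}=\theta-1$). Then $\alpha_\delta^{\theta,*}\ge\underline r(\delta)$. In particular, $\alpha_\delta^{\theta,*}\ge1+W_0\left(\frac{\theta-1}{e}\right)+\Omega(\delta)$ as $\delta\downarrow0$ (implied constant depending on $\theta$), and $\alpha_\delta^{\theta,*}\ge\sqrt\theta$ when $\delta\ge\frac12$.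
   Context: One-max search: prices $v_1,\dots,v_T\in[L,U]$ arrive online ($T$ unknown); a player sells one item at an accepted price, or at price $L$ if it never accepts. A random threshold algorithm draws $X$ from a distribution $\mu$ on $[L,U]$ and accepts the first price at least $X$; against a sequence with maximal price $v\in[L,U]$ its profit is $L\cdot\mathbb{1}_{X>v}+X\cdot\mathbb{1}_{X\le v}$. Conditional value-at-risk for rewards: for $\delta\in[0,1)$, $\mathrm{CVaR}_\delta[Y]=\sup_{t\in\mathbb{R}}\{t-\frac{1}{1-\delta}\mathbb{E}[(t-Y)^+]\}=\frac{1}{1-\delta}\int_0^{1-\delta}F_Y^{-1}(p)\,dp$, and $\mathrm{CVaR}_1[Y]=\operatorname{ess\,inf}Y$. The $\mathrm{CVaR}_\delta$-competitive ratio of $\mu$ is $\alpha_\delta^{\theta,\mu}=\sup_{v\in[L,U]}\frac{v}{\mathrm{CVaR}_\delta[L\cdot\mathbb{1}_{X>v}+X\cdot\mathbb{1}_{X\le v}]}$, and $\alpha_\delta^{\theta,*}=\inf_\mu\alpha_\delta^{\theta,\mu}$ over random threshold algorithms (the paper notes any randomized algorithm can be approximated arbitrarily well by random threshold algorithms). $W_0$ is the principal branch of the Lambert $W$ function.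
   Formalization: The bound with the Ω(δ) term is stated for θ>1 only: for θ=1 (L=U) the optimal ratio is exactly 1 = 1+W_0(0) for every δ, so no positive implied constant exists; the other claims cover all θ≥1. *)

theory Defs
  imports "HOL-Probability.Probability"
begin

text \<open>Conditional value-at-risk for rewards (so the lower tail is the bad one). All quantities are
  extended reals, so no supremum or infimum takes a default value. At level \<open>1\<close> it is the
  essential infimum, written through the library's \<open>esssup\<close>.\<close>

definition cvar :: "real \<Rightarrow> 'a measure \<Rightarrow> ('a \<Rightarrow> real) \<Rightarrow> ereal" where
  "cvar \<delta> M Y =
     (if \<delta> < 1 then (SUP t. ereal (t - 1 / (1 - \<delta>) * (\<integral>\<omega>. max 0 (t - Y \<omega>) \<partial>M)))
      else - esssup M (\<lambda>\<omega>. - ereal (Y \<omega>)))"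

definition threshold_algorithms :: "real \<Rightarrow> real \<Rightarrow> real measure set" where
  "threshold_algorithms L U = {\<mu>. real_distribution \<mu> \<and> emeasure \<mu> {L..U} = 1}"

definition threshold_profit :: "real \<Rightarrow> real \<Rightarrow> real \<Rightarrow> real" where
  "threshold_profit L v x = L * indicator {x. x > v} x + x * indicator {x. x \<le> v} x"

definition cvar_ratio :: "real \<Rightarrow> real \<Rightarrow> real \<Rightarrow> real measure \<Rightarrow> ereal" where
  "cvar_ratio L U \<delta> \<mu> = (SUP v\<in>{L..U}. ereal v / cvar \<delta> \<mu> (threshold_profit L v))"

definition optimal_cvar_ratio :: "real \<Rightarrow> real \<Rightarrow> real \<Rightarrow> ereal" where
  "optimal_cvar_ratio L U \<delta> = (INF \<mu>\<in>threshold_algorithms L U. cvar_ratio L U \<delta> \<mu>)"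

definition n_lower :: "real \<Rightarrow> nat" where
  "n_lower \<delta> = nat (max 1 (\<lceil>1 / \<delta>\<rceil> - 1))"

text \<open>For \<open>\<delta> = 0\<close> the left-hand side is the limit for \<open>\<delta> \<down> 0\<close>; see
  \<open>r_lower_lhs_tendsto\<close> below.\<close>

definition r_lower_lhs :: "real \<Rightarrow> real \<Rightarrow> real" where
  "r_lower_lhs \<delta> r =
     (if \<delta> = 0 then (r - 1) * exp r
      else (r - 1) * (1 + r / real (n_lower \<delta>)) ^ n_lower \<delta>)"

definition r_lower :: "real \<Rightarrow> real \<Rightarrow> real" where
  "r_lower \<theta> \<delta> = (THE r. 0 < r \<and> r_lower_lhs \<delta> r = \<theta> - 1)"

text \<open>Principal branch of the Lambert \<open>W\<close> function, meaningful for arguments \<open>\<ge> - 1 / e\<close>.\<close>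

definition lambert_W0 :: "real \<Rightarrow> real" where
  "lambert_W0 x = (THE w. - 1 \<le> w \<and> w * exp w = x)"

lemma filterlim_n_lower: "filterlim n_lower at_top (at_right 0)"
proof -
  have 1: "filterlim (\<lambda>\<delta>::real. - 1 + inverse \<delta>) at_top (at_right 0)"
    by (rule filterlim_tendsto_add_at_top[OF tendsto_const filterlim_inverse_at_top_right])
  have "- 1 + inverse \<delta> \<le> real (n_lower \<delta>)" for \<delta>
    unfolding n_lower_def inverse_eq_divide by linarith
  then show ?thesis
    unfolding filterlim_sequentially_iff_filterlim_real
    by (intro filterlim_at_top_mono[OF 1]) auto
qed

lemma r_lower_lhs_tendsto: "((\<lambda>\<delta>. r_lower_lhs \<delta> r) \<longlongrightarrow> r_lower_lhs 0 r) (at_right 0)"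
proof -
  have "((\<lambda>\<delta>. (r - 1) * (1 + r / real (n_lower \<delta>)) ^ n_lower \<delta>) \<longlongrightarrow> (r - 1) * exp r) (at_right 0)"
    by (intro tendsto_mult tendsto_const
        filterlim_compose[OF tendsto_exp_limit_sequentially filterlim_n_lower])
  moreover have "\<forall>\<^sub>F \<delta> in at_right 0.
      (r - 1) * (1 + r / real (n_lower \<delta>)) ^ n_lower \<delta> = r_lower_lhs \<delta> r"
    by (auto simp: r_lower_lhs_def eventually_at_filter)
  ultimately show ?thesis
    by (auto simp: r_lower_lhs_def[of 0] intro: Lim_transform_eventually)
qed

end

theory Submission
  imports Defs
begin

text \<open>Suppose that a distribution of the threshold \<open>X\<close> has ratio below \<open>\<beta>\<close>. With \<open>n = n_lower \<delta>\<close>, monotonicity in the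
  level lets us replace \<open>\<delta>\<close> by \<open>1 / (n + 1)\<close>. Consider the prices
  \<open>w i = L + (\<beta> - 1) * L * (1 + \<beta> / n) ^ i\<close>. If \<open>X \<le> w j\<close> has probability at least \<open>(j + 1) / (n + 1)\<close>
  for all \<open>j < i\<close> but at most \<open>(i + 1) / (n + 1)\<close> for \<open>j = i\<close>, then against the price \<open>w i\<close> the profit, after
  removal of its best \<open>1 / (n + 1)\<close> fraction, averages at most \<open>w i / \<beta>\<close>, a contradiction. So the probability of
  \<open>X \<le> w i\<close> exceeds \<open>(i + 1) / (n + 1)\<close> as long as \<open>w i \<le> U\<close>; as it cannot exceed \<open>1\<close>, we get \<open>w n > U\<close>, which
  is the inequality \<open>\<theta> - 1 < (\<beta> - 1) * (1 + \<beta> / n) ^ n\<close>. For \<open>\<delta> = 0\<close> the same is applied for all \<open>n\<close>, with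
  \<open>\<beta>\<close> slightly increased, and \<open>n\<close> tends to infinity.\<close>

section \<open>Roots and monotonicity of the equation for \<open>r_lower\<close>\<close>

text \<open>On \<open>0 < r < 1\<close> the product is negative. From its zero at
  \<open>r = 1\<close> it increases strictly, and at \<open>r = \<theta>\<close> it has reached
  \<open>\<theta> - 1\<close> because \<open>h \<ge> 1\<close>; the intermediate value theorem
  applies.\<close>

lemma ex1_monotone_product_root:
  fixes h :: "real \<Rightarrow> real"
  assumes cont: "continuous_on {1..} h"
    and h_pos: "\<And>r. 0 < r \<Longrightarrow> 1 \<le> h r"
    and h_mono: "\<And>r s. 0 < r \<Longrightarrow> r \<le> s \<Longrightarrow> h r \<le> h s"
    and "1 \<le> \<theta>"
  shows "\<exists>!r. 0 < r \<and> (r - 1) * h r = \<theta> - 1"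
proof -
  have "1 * (\<theta> - 1) \<le> h \<theta> * (\<theta> - 1)"
    using assms by (intro mult_right_mono) auto
  moreover have "continuous_on {1..\<theta>} (\<lambda>r. (r - 1) * h r)"
    by (intro continuous_intros continuous_on_subset[OF cont]) auto
  ultimately obtain r where r: "1 \<le> r" "(r - 1) * h r = \<theta> - 1"
    using IVT'[of "\<lambda>r. (r - 1) * h r" 1 "\<theta> - 1" \<theta>] \<open>1 \<le> \<theta>\<close> by (auto simp: mult.commute)
  have ge1: "1 \<le> s" if "0 < s" "(s - 1) * h s = \<theta> - 1" for s
  proof (rule ccontr)
    assume "\<not> 1 \<le> s"
    then have "(s - 1) * h s < 0"
      using h_pos[of s] that by (intro mult_neg_pos) auto
    then show False using that \<open>1 \<le> \<theta>\<close> by simp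
  qed
  have strict: "(s - 1) * h s < (t - 1) * h t" if "1 \<le> s" "s < t" for s t
    using that h_mono[of s t] h_pos[of s] by (intro mult_less_le_imp_less) auto
  show ?thesis
  proof (rule ex1I[of _ r])
    show "0 < r \<and> (r - 1) * h r = \<theta> - 1" using r by simp
  next
    fix s assume s: "0 < s \<and> (s - 1) * h s = \<theta> - 1"
    then show "s = r"
      using ge1[of s] strict[of s r] strict[of r s] r by (cases s r rule: linorder_cases) auto
  qed
qed

lemma n_lower_ge_1: "1 \<le> n_lower \<delta>"
  unfolding n_lower_def by linarith

text \<open>Splitting off this factor, monotone and at least 1 for positive \<open>r\<close>, lets
  the exponential case and the power case share the arguments on roots and growth.\<close>

definition r_lower_factor :: "real \<Rightarrow> real \<Rightarrow> real" where
  "r_lower_factor \<delta> r = (if \<delta> = 0 then exp r else (1 + r / real (n_lower \<delta>)) ^ n_lower \<delta>)"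

lemma r_lower_lhs_eq: "r_lower_lhs \<delta> r = (r - 1) * r_lower_factor \<delta> r"
  by (simp add: r_lower_lhs_def r_lower_factor_def)

lemma continuous_on_r_lower_factor: "continuous_on A (r_lower_factor \<delta>)"
proof (cases "\<delta> = 0")
  case True
  then have "r_lower_factor \<delta> = exp" by (simp add: r_lower_factor_def fun_eq_iff)
  then show ?thesis by (simp add: continuous_on_exp)
next
  case False
  then have "r_lower_factor \<delta> = (\<lambda>r. (1 + r / real (n_lower \<delta>)) ^ n_lower \<delta>)"
    by (simp add: r_lower_factor_def fun_eq_iff)
  then show ?thesis
    using n_lower_ge_1[of \<delta>] by (auto intro!: continuous_intros)
qed

lemma r_lower_factor_ge_1: "0 < r \<Longrightarrow> 1 \<le> r_lower_factor \<delta> r"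
  by (auto simp: r_lower_factor_def intro!: one_le_power)

lemma r_lower_factor_mono: "0 < r \<Longrightarrow> r \<le> s \<Longrightarrow> r_lower_factor \<delta> r \<le> r_lower_factor \<delta> s"
  by (auto simp: r_lower_factor_def intro!: power_mono divide_right_mono)

lemma ex1_r_lower:
  assumes "1 \<le> \<theta>"
  shows "\<exists>!r. 0 < r \<and> r_lower_lhs \<delta> r = \<theta> - 1"
  unfolding r_lower_lhs_eq
  using continuous_on_r_lower_factor r_lower_factor_ge_1 r_lower_factor_mono assms
  by (rule ex1_monotone_product_root)

lemma r_lower_lhs_strict_mono:
  assumes "1 \<le> s" "s < t"
  shows "r_lower_lhs \<delta> s < r_lower_lhs \<delta> t"
proof -
  have "0 < r_lower_factor \<delta> s"
    using r_lower_factor_ge_1[of s \<delta>] assms by linarith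
  then show ?thesis
    unfolding r_lower_lhs_eq using assms r_lower_factor_mono[of s t \<delta>]
    by (intro mult_less_le_imp_less) auto
qed

lemma r_lower_lhs_neg:
  assumes "0 < r" "r < 1"
  shows "r_lower_lhs \<delta> r < 0"
  unfolding r_lower_lhs_eq using r_lower_factor_ge_1[of r \<delta>] assms by (intro mult_neg_pos) auto

lemma r_lower_works:
  assumes "1 \<le> \<theta>"
  shows "0 < r_lower \<theta> \<delta>" "r_lower_lhs \<delta> (r_lower \<theta> \<delta>) = \<theta> - 1"
  using theI'[OF ex1_r_lower[OF assms, of \<delta>]] unfolding r_lower_def by auto

lemma r_lower_eqI:
  assumes "1 \<le> \<theta>" "0 < r" "r_lower_lhs \<delta> r = \<theta> - 1"
  shows "r_lower \<theta> \<delta> = r"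
  using ex1_r_lower[OF assms(1), of \<delta>] r_lower_works[OF assms(1), of \<delta>] assms(2,3) by blast

text \<open>Strict growth on \<open>r \<ge> 1\<close>, where the root itself lies, reduces a lower
  bound on \<open>r_lower\<close> to evaluating the left-hand side at a test point.\<close>

lemma le_r_lowerI:
  assumes "1 \<le> \<theta>" "1 \<le> r" "r_lower_lhs \<delta> r \<le> \<theta> - 1"
  shows "r \<le> r_lower \<theta> \<delta>"
proof (rule ccontr)
  assume "\<not> ?thesis"
  moreover have "1 \<le> r_lower \<theta> \<delta>"
    using r_lower_lhs_neg[of "r_lower \<theta> \<delta>" \<delta>] r_lower_works[OF assms(1), of \<delta>] assms(1) by linarith
  ultimately show False
    using r_lower_lhs_strict_mono[of "r_lower \<theta> \<delta>" r \<delta>] r_lower_works[OF assms(1), of \<delta>] assms by simp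
qed

section \<open>Special levels of \<open>r_lower\<close>: \<open>\<delta> \<ge> 1/2\<close>,
  \<open>\<delta> = 0\<close> and the growth near 0\<close>

lemma r_lower_half:
  assumes "1 \<le> \<theta>" "1 / 2 \<le> \<delta>"
  shows "r_lower \<theta> \<delta> = sqrt \<theta>"
proof (rule r_lower_eqI[OF assms(1)])
  have "1 / \<delta> \<le> 2" using assms by (simp add: field_simps)
  then have "\<lceil>1 / \<delta>\<rceil> \<le> 2" by (simp add: ceiling_le_iff)
  then have "n_lower \<delta> = 1" unfolding n_lower_def by simp
  then show "r_lower_lhs \<delta> (sqrt \<theta>) = \<theta> - 1"
    using assms by (simp add: r_lower_lhs_def algebra_simps)
qed (use assms in auto)

text \<open>The substitution \<open>r = w + 1\<close>, after multiplication by \<open>exp 1\<close>,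
  carries the Lambert equation into the one at level 0.\<close>

lemma lambert_W0_eq_r_lower:
  assumes "1 < \<theta>"
  shows "1 + lambert_W0 ((\<theta> - 1) / exp 1) = r_lower \<theta> 0"
proof -
  have iff: "-1 \<le> w \<and> w * exp w = (\<theta> - 1) / exp 1 \<longleftrightarrow> 0 < w + 1 \<and> r_lower_lhs 0 (w + 1) = \<theta> - 1" for w
  \<comment> \<open>The ranges \<open>-1 \<le> w\<close> and \<open>0 < w + 1\<close> differ only at
    this point, which solves neither equation.\<close>
  proof (cases "w = -1")
    case True
    have "w * exp w < 0" "0 < (\<theta> - 1) / exp 1"
      using True assms by auto
    then show ?thesis using True by linarith
  next
    case False
    have "w * exp w = (\<theta> - 1) / exp 1 \<longleftrightarrow> w * exp w * exp 1 = \<theta> - 1"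
      by (simp add: eq_divide_eq)
    also have "\<dots> \<longleftrightarrow> r_lower_lhs 0 (w + 1) = \<theta> - 1"
      by (simp add: r_lower_lhs_def exp_add mult.assoc)
    finally show ?thesis using False by linarith
  qed
  have "lambert_W0 ((\<theta> - 1) / exp 1) = r_lower \<theta> 0 - 1"
    unfolding lambert_W0_def iff
  proof (rule the_equality)
    show "0 < r_lower \<theta> 0 - 1 + 1 \<and> r_lower_lhs 0 (r_lower \<theta> 0 - 1 + 1) = \<theta> - 1"
      using r_lower_works[of \<theta> 0] assms by simp
  next
    fix w assume "0 < w + 1 \<and> r_lower_lhs 0 (w + 1) = \<theta> - 1"
    then show "w = r_lower \<theta> 0 - 1"
      using r_lower_eqI[of \<theta> "w + 1" 0] assms by simp
  qed
  then show ?thesis by simp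
qed

text \<open>With \<open>y = x - x\<^sup>2 / 4 \<ge> 3/4 * x\<close>, the Taylor term
  \<open>y\<^sup>2 / 2\<close> is at least \<open>9/32 * x\<^sup>2\<close>, which outweighs the
  subtracted \<open>x\<^sup>2 / 4\<close>.\<close>

lemma one_plus_le_exp_quadratic:
  assumes "0 \<le> x" "x \<le> (1::real)"
  shows "1 + x \<le> exp (x - x\<^sup>2 / 4)"
proof -
  let ?y = "x - x\<^sup>2 / 4"
  have y: "3 / 4 * x \<le> ?y"
    using assms by (simp add: power2_eq_square mult_left_le)
  then have "0 \<le> ?y" using assms by linarith
  then have "1 + ?y + ?y\<^sup>2 / 2 \<le> exp ?y"
    by (rule exp_lower_Taylor_quadratic)
  moreover have "(3 / 4 * x)\<^sup>2 \<le> ?y\<^sup>2"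
    using y assms by (intro power_mono) auto
  then have "x\<^sup>2 / 2 \<le> ?y\<^sup>2"
    by (simp add: power_mult_distrib power2_eq_square) (smt (verit) zero_le_square)
  ultimately show ?thesis by linarith
qed

text \<open>By \<open>le_r_lowerI\<close> it is enough to test the point
  \<open>r0 + c * \<delta>\<close>. At \<open>\<theta> = 1\<close> the root is 1 at every level, so
  there is no linear gain.\<close>

lemma r_lower_first_order:
  assumes "1 < \<theta>"
  shows "\<exists>c>0. \<forall>\<^sub>F \<delta> in at_right 0. r_lower \<theta> 0 + c * \<delta> \<le> r_lower \<theta> \<delta>"
proof -
  define r0 where "r0 = r_lower \<theta> 0"
  have r0: "0 < r0" "(r0 - 1) * exp r0 = \<theta> - 1"
    using r_lower_works[of \<theta> 0] assms by (auto simp: r_lower_lhs_def r0_def)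
  have "1 < r0"
    using r0 assms by (smt (verit) exp_gt_zero mult_nonpos_nonneg)
  define c where "c = (r0 - 1) / (4 * r0)"
  \<comment> \<open>As \<open>\<delta> \<le> 1 / n\<close>, the power \<open>(1 + r / n) ^ n\<close> falls short of \<open>exp r\<close> by a factor of at least
    \<open>exp (\<delta> / 4)\<close>; this \<open>c\<close> makes the growth of \<open>(r - 1) * exp r\<close> from \<open>r0\<close> to \<open>r0 + c * \<delta>\<close> at most
    that factor.\<close>
  have c: "0 < c" "c \<le> 1" using \<open>1 < r0\<close> by (auto simp: c_def field_simps)
  have c_eq: "c + c / (r0 - 1) = 1 / 4"
    using \<open>1 < r0\<close> by (simp add: c_def divide_simps)
  \<comment> \<open>This ensures \<open>?r / ?n \<le> 1\<close> below, the range of the quadratic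
    estimate.\<close>
  have "\<forall>\<^sub>F \<delta> in at_right 0. nat \<lceil>r0 + 1\<rceil> \<le> n_lower \<delta>"
    using filterlim_n_lower by (simp add: filterlim_at_top)
  moreover have "\<forall>\<^sub>F \<delta> in at_right (0::real). 0 < \<delta> \<and> \<delta> < 1"
    using eventually_at_right_real[of 0 1] by (auto elim: eventually_mono)
  ultimately have "\<forall>\<^sub>F \<delta> in at_right 0. r0 + c * \<delta> \<le> r_lower \<theta> \<delta>"
  proof eventually_elim
    case (elim \<delta>)
    let ?n = "real (n_lower \<delta>)" let ?r = "r0 + c * \<delta>"
    have n: "r0 + 1 \<le> ?n" using elim(1) by linarith
    have r: "r0 \<le> ?r" "?r \<le> r0 + 1" using elim c by (auto intro: mult_le_one)
    have "?n \<le> 1 / \<delta>"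
      using elim(2) unfolding n_lower_def by (smt (verit) ceiling_correct le_divide_eq_1_pos of_int_le_iff of_nat_nat of_int_1 of_int_diff)
    then have \<delta>n: "\<delta> \<le> 1 / ?n"
      using n r0(1) elim(2) by (simp add: field_simps)
    have "1 + ?r / ?n \<le> exp (?r / ?n - (?r / ?n)\<^sup>2 / 4)"
      using n r \<open>1 < r0\<close> by (intro one_plus_le_exp_quadratic) auto
    then have "(1 + ?r / ?n) ^ n_lower \<delta> \<le> exp (?r / ?n - (?r / ?n)\<^sup>2 / 4) ^ n_lower \<delta>"
      using n r \<open>1 < r0\<close> by (intro power_mono) auto
    also have "\<dots> = exp (?r - ?r\<^sup>2 * (1 / ?n) / 4)"
      using n r0(1) unfolding exp_of_nat_mult[symmetric] by (simp add: field_simps power2_eq_square)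
    also have "\<dots> \<le> exp (?r - \<delta> / 4)"
    proof -
      have "1 * \<delta> \<le> ?r\<^sup>2 * (1 / ?n)"
        using \<delta>n r \<open>1 < r0\<close> elim(2) by (intro mult_mono one_le_power) auto
      then show ?thesis by simp
    qed
    finally have power_le: "(1 + ?r / ?n) ^ n_lower \<delta> \<le> exp (?r - \<delta> / 4)" .
    \<comment> \<open>The linear factor is also put into the exponent; by \<open>c_eq\<close> all
      terms in \<open>\<delta>\<close> there then cancel, leaving
      \<open>(r0 - 1) * exp r0\<close>.\<close>
    have "?r - 1 = (r0 - 1) * (1 + c * \<delta> / (r0 - 1))"
      using \<open>1 < r0\<close> by (simp add: field_simps)
    also have "\<dots> \<le> (r0 - 1) * exp (c * \<delta> / (r0 - 1))"
      using \<open>1 < r0\<close> by (intro mult_left_mono exp_ge_add_one_self) auto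
    finally have "r_lower_lhs \<delta> ?r \<le> ((r0 - 1) * exp (c * \<delta> / (r0 - 1))) * exp (?r - \<delta> / 4)"
      using power_le r \<open>1 < r0\<close> elim(2) n by (simp add: r_lower_lhs_def) (intro mult_mono; simp)
    also have "\<dots> = (r0 - 1) * exp (r0 + \<delta> * (c + c / (r0 - 1)) - \<delta> / 4)"
      by (simp add: exp_add[symmetric] algebra_simps)
    also have "\<dots> = \<theta> - 1"
      using r0 by (simp add: c_eq)
    finally show ?case
      using r \<open>1 < r0\<close> assms by (intro le_r_lowerI) auto
  qed
  then show ?thesis using c unfolding r0_def by blast
qed

section \<open>Threshold distributions, their shortfall and the geometric price sequence\<close>

lemma threshold_algorithmsD:
  assumes "\<mu> \<in> threshold_algorithms L U"
  shows "prob_space \<mu>" "sets \<mu> = sets borel" "AE x in \<mu>. x \<in> {L..U}"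
proof -
  interpret real_distribution \<mu>
    using assms by (simp add: threshold_algorithms_def)
  show "prob_space \<mu>" by unfold_locales
  show "sets \<mu> = sets borel" by simp
  show "AE x in \<mu>. x \<in> {L..U}"
    by (subst AE_in_set_eq_1) (use assms in \<open>auto simp: threshold_algorithms_def emeasure_eq_measure\<close>)
qed

lemma threshold_profit_eq: "threshold_profit L v x = (if x \<le> v then x else L)"
  by (simp add: threshold_profit_def)

lemma threshold_profit_ge:
  assumes "\<mu> \<in> threshold_algorithms L U"
  shows "AE x in \<mu>. L \<le> threshold_profit L v x"
  using threshold_algorithmsD(3)[OF assms] by eventually_elim (auto simp: threshold_profit_eq)

lemma borel_measurable_threshold_profit [measurable]:
  "threshold_profit L v \<in> borel_measurable borel"
  unfolding threshold_profit_def by measurable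

lemma integrable_shortfall:
  assumes "\<mu> \<in> threshold_algorithms L U"
  shows "integrable \<mu> (\<lambda>x. max 0 (t - threshold_profit L v x))"
proof -
  interpret prob_space \<mu> using threshold_algorithmsD(1)[OF assms] .
  note [measurable_cong] = threshold_algorithmsD(2)[OF assms]
  show ?thesis
  proof (rule integrable_const_bound[of _ "\<bar>t - L\<bar>"])
    show "AE x in \<mu>. norm (max 0 (t - threshold_profit L v x)) \<le> \<bar>t - L\<bar>"
      using threshold_profit_ge[OF assms, of v] by eventually_elim auto
  qed measurable
qed

text \<open>The prices \<open>w 0 \<le> \<dots> \<le> w k\<close> act as upper bounds for the quantiles of \<open>\<mu>\<close>, at multiples of
  \<open>1 / (n + 1)\<close>.\<close>

lemma shortfall_bound:
  fixes w :: "nat \<Rightarrow> real"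
  assumes \<mu>: "\<mu> \<in> threshold_algorithms L U" and n: "1 \<le> n"
    and w: "mono w" "L \<le> w 0"
    and lower: "\<And>i. i < k \<Longrightarrow> (real i + 1) / (real n + 1) \<le> measure \<mu> {..w i}"
    and upper: "measure \<mu> {..w k} \<le> (real k + 1) / (real n + 1)"
  shows "t - (1 + 1 / real n) * (\<integral>x. max 0 (t - threshold_profit L (w k) x) \<partial>\<mu>)
    \<le> L + (\<Sum>i<k. w i - L) / n"
proof -
  interpret prob_space \<mu> using threshold_algorithmsD(1)[OF \<mu>] .
  note [measurable_cong, simp] = threshold_algorithmsD(2)[OF \<mu>]
  have sum_nonneg: "0 \<le> (\<Sum>i<k. w i - L)"
    by (intro sum_nonneg) (use w in \<open>smt (verit) monoD le0\<close>)
  show ?thesis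
  proof (cases "L \<le> t")
    case False
    have "0 \<le> (\<integral>x. max 0 (t - threshold_profit L (w k) x) \<partial>\<mu>)" by simp
    then have "0 \<le> (1 + 1 / real n) * (\<integral>x. max 0 (t - threshold_profit L (w k) x) \<partial>\<mu>)" by simp
    moreover have "0 \<le> (\<Sum>i<k. w i - L) / n" using sum_nonneg by simp
    ultimately show ?thesis using False by linarith
  next
    case True
    define a where "a i = min t (w i) - L" for i
    \<comment> \<open>This is the step function equal to \<open>a 0\<close> up to
      \<open>w 0\<close>, to \<open>a i\<close> between \<open>w (i - 1)\<close> and
      \<open>w i\<close>, and to 0 beyond \<open>w k\<close>. In this summed-by-parts form only the
      event of \<open>w k\<close> has a positive sign, so \<open>upper\<close> is needed there and
      \<open>lower\<close> at all other indices.\<close>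
    define g where "g k x = a k * indicator {..w k} x - (\<Sum>i<k. (a (Suc i) - a i) * indicator {..w i} x)" for k x
    have a_mono: "a i \<le> a (Suc i)" for i
      using w(1) unfolding a_def by (smt (verit) monoD le_SucI order_refl)
    have a_nonneg: "0 \<le> a i" for i
      using w True monoD[OF w(1), of 0 i] by (simp add: a_def)
    have g: "min t (threshold_profit L (w k) x) - L \<le> g k x" for k x
    proof (induction k)
      case 0
      then show ?case
        using True by (auto simp: g_def a_def threshold_profit_eq)
    next
      case (Suc k)
      have "g (Suc k) x = g k x + a (Suc k) * (indicator {..w (Suc k)} x - indicator {..w k} x)"
        by (simp add: g_def algebra_simps)
      then show ?case
        using Suc True a_nonneg[of "Suc k"] monoD[OF w(1), of k "Suc k"]
        by (auto simp: threshold_profit_eq a_def indicator_def split: if_splits)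
    qed
    have g_int: "integrable \<mu> (g k)"
      unfolding g_def by (intro Bochner_Integration.integrable_diff integrable_mult_right Bochner_Integration.integrable_sum) (auto simp: less_top[symmetric])
    have abel: "a k * (real k + 1) - (\<Sum>i<k. (a (Suc i) - a i) * (real i + 1)) = a k + (\<Sum>i<k. a i)" for k
      by (induction k) (auto simp: algebra_simps)
    have "(\<integral>x. g k x \<partial>\<mu>) = a k * measure \<mu> {..w k} - (\<Sum>i<k. (a (Suc i) - a i) * measure \<mu> {..w i})"
    proof -
      have int: "integrable \<mu> (\<lambda>x. c * indicator {..b} x :: real)" for b c
        by (intro integrable_mult_right) (auto simp: less_top[symmetric])
      show ?thesis
        unfolding g_def
        by (simp only: Bochner_Integration.integral_diff[OF int Bochner_Integration.integrable_sum[OF int]]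
            Bochner_Integration.integral_sum[OF int]) simp
    qed
    also have "\<dots> \<le> a k * ((real k + 1) / (real n + 1)) - (\<Sum>i<k. (a (Suc i) - a i) * ((real i + 1) / (real n + 1)))"
      using upper lower a_nonneg a_mono
      by (intro diff_mono mult_left_mono sum_mono) (auto simp: add.commute)
    also have "\<dots> = (a k * (real k + 1) - (\<Sum>i<k. (a (Suc i) - a i) * (real i + 1))) / (real n + 1)"
      by (simp add: diff_divide_distrib sum_divide_distrib)
    also have "\<dots> = (a k + (\<Sum>i<k. a i)) / (real n + 1)"
      by (simp only: abel)
    \<comment> \<open>The top cell is bounded by \<open>t\<close> rather than \<open>w k\<close>: it
      is the discarded best fraction, and multiplying by \<open>1 + 1 / n\<close> makes
      \<open>t\<close> cancel.\<close>
    also have "\<dots> \<le> (t - L + (\<Sum>i<k. w i - L)) / (real n + 1)"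
      by (intro divide_right_mono add_mono sum_mono) (auto simp: a_def)
    finally have g_le: "(\<integral>x. g k x \<partial>\<mu>) \<le> (t - L + (\<Sum>i<k. w i - L)) / (real n + 1)" .
    have "t - L - (\<integral>x. g k x \<partial>\<mu>) = (\<integral>x. t - L - g k x \<partial>\<mu>)"
      using g_int by (subst Bochner_Integration.integral_diff) (auto simp: prob_space)
    also have "\<dots> \<le> (\<integral>x. max 0 (t - threshold_profit L (w k) x) \<partial>\<mu>)"
      using g_int integrable_shortfall[OF \<mu>]
    proof (intro integral_mono)
      show "t - L - g k x \<le> max 0 (t - threshold_profit L (w k) x)" for x
        using g[of k x] by linarith
    qed auto
    finally have "t - L - (t - L + (\<Sum>i<k. w i - L)) / (real n + 1)
        \<le> (\<integral>x. max 0 (t - threshold_profit L (w k) x) \<partial>\<mu>)"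
      using g_le by linarith
    then have "(1 + 1 / real n) * (t - L - (t - L + (\<Sum>i<k. w i - L)) / (real n + 1))
        \<le> (1 + 1 / real n) * (\<integral>x. max 0 (t - threshold_profit L (w k) x) \<partial>\<mu>)"
      by (intro mult_left_mono) auto
    moreover have "(1 + 1 / real n) * (t - L - (t - L + S) / (real n + 1)) = t - L - S / n" for S
      using n by (simp add: divide_simps) (simp add: algebra_simps)
    ultimately have "t - L - (\<Sum>i<k. w i - L) / n
        \<le> (1 + 1 / real n) * (\<integral>x. max 0 (t - threshold_profit L (w k) x) \<partial>\<mu>)"
      by simp
    then show ?thesis by linarith
  qed
qed

text \<open>\<open>good\<close> unfolds a ratio below \<open>\<beta>\<close> at level
  \<open>1 / (n + 1)\<close>, whose loss factor is \<open>1 + 1 / n\<close>. Asking only for some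
  \<open>t\<close> keeps it applicable to level 1 as well.\<close>

lemma threshold_ratio_gt:
  assumes \<mu>: "\<mu> \<in> threshold_algorithms L U" and n: "1 \<le> n" and LU: "0 < L" "L \<le> U" and \<beta>: "0 < \<beta>"
    and good: "\<And>v. v \<in> {L..U} \<Longrightarrow>
      \<exists>t. v / \<beta> < t - (1 + 1 / real n) * (\<integral>x. max 0 (t - threshold_profit L v x) \<partial>\<mu>)"
  shows "1 < \<beta>" "U / L - 1 < (\<beta> - 1) * (1 + \<beta> / n) ^ n"
proof -
  interpret prob_space \<mu> using threshold_algorithmsD(1)[OF \<mu>] .
  \<comment> \<open>Against the price \<open>L\<close> the profit is almost surely \<open>L\<close>,
    so no \<open>t\<close> yields more than \<open>L\<close>.\<close>
  show "1 < \<beta>"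
  proof -
    obtain t where t: "L / \<beta> < t - (1 + 1 / real n) * (\<integral>x. max 0 (t - threshold_profit L L x) \<partial>\<mu>)"
      using good[of L] LU by auto
    also have "\<dots> \<le> L"
    proof -
      have "AE x in \<mu>. t - L \<le> max 0 (t - threshold_profit L L x)"
        using threshold_algorithmsD(3)[OF \<mu>] by eventually_elim (auto simp: threshold_profit_eq)
      then have "(\<integral>x. t - L \<partial>\<mu>) \<le> (\<integral>x. max 0 (t - threshold_profit L L x) \<partial>\<mu>)"
        using integrable_shortfall[OF \<mu>] by (intro integral_mono_AE) auto
      then have "t - L \<le> (\<integral>x. max 0 (t - threshold_profit L L x) \<partial>\<mu>)" by (simp add: prob_space)
      moreover have "0 \<le> (\<integral>x. max 0 (t - threshold_profit L L x) \<partial>\<mu>) / n" by simp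
      ultimately show ?thesis unfolding distrib_right mult_1 times_divide_eq_left by linarith
    qed
    finally show ?thesis using LU \<beta> by (simp add: field_simps)
  qed
  define q where "q = 1 + \<beta> / n"
  \<comment> \<open>This solves the recursion
    \<open>w k = \<beta> * (L + (\<Sum>i<k. w i - L) / n)\<close>, which starts at
    \<open>\<beta> * L\<close> and makes the bound of \<open>shortfall_bound\<close> exactly
    \<open>w k / \<beta>\<close>.\<close>
  define w where "w i = L + (\<beta> - 1) * L * q ^ i" for i
  have "1 \<le> q" using \<beta> by (simp add: q_def)
  then have w: "mono w" "L \<le> w 0"
    using \<open>1 < \<beta>\<close> LU by (auto simp: mono_def w_def intro!: mult_left_mono power_increasing)
  have w_sum: "L + (\<Sum>i<k. w i - L) / n = w k / \<beta>" for k
  proof -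
    have "q \<noteq> 1" using \<beta> n by (simp add: q_def)
    have "(\<Sum>i<k. w i - L) = (\<beta> - 1) * L * ((q ^ k - 1) / (q - 1))"
      using geometric_sum[OF \<open>q \<noteq> 1\<close>, of k] by (simp add: w_def sum_distrib_left[symmetric])
    also have "q - 1 = \<beta> / n" by (simp add: q_def)
    finally show ?thesis
      using \<beta> n by (simp add: w_def divide_simps) (simp add: algebra_simps)
  qed
  have step: "(real k + 1) / (real n + 1) < measure \<mu> {..w k}" if "w k \<le> U" for k
    using that
  proof (induction k rule: less_induct)
    case (less k)
    have "(real i + 1) / (real n + 1) \<le> measure \<mu> {..w i}" if "i < k" for i
      using less.IH[OF that] less.prems that monoD[OF w(1), of i k] by simp
    note lower = this
    have bound: "t - (1 + 1 / real n) * (\<integral>x. max 0 (t - threshold_profit L (w k) x) \<partial>\<mu>) \<le> w k / \<beta>"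
      if "measure \<mu> {..w k} \<le> (real k + 1) / (real n + 1)" for t
      using shortfall_bound[OF \<mu> n w lower that, of t] w_sum[of k] by simp
    have "w k \<in> {L..U}"
      using less.prems monoD[OF w(1), of 0 k] w(2) by auto
    then show ?case
      using good[of "w k"] bound by (meson not_less)
  qed
  have "U < w n"
    using step[of n] prob_le_1[of "{..w n}"] by (auto simp: not_less[symmetric])
  then show "U / L - 1 < (\<beta> - 1) * (1 + \<beta> / n) ^ n"
    using LU by (simp add: w_def q_def field_simps)
qed

section \<open>Bounds for \<open>cvar\<close>, uniform in the level\<close>

text \<open>Below level 1 the choice \<open>t = c\<close> has no shortfall. With
  \<open>c = L\<close> this makes the denominators of the ratio positive, so the ratio can be
  rearranged.\<close>

lemma AE_le_imp_cvar_ge: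
  assumes "prob_space M" "Y \<in> borel_measurable M" "AE x in M. c \<le> Y x"
  shows "ereal c \<le> cvar \<delta> M Y"
proof (cases "\<delta> < 1")
  case True
  have "(\<integral>x. max 0 (c - Y x) \<partial>M) = (\<integral>x. 0 \<partial>M)"
    using assms by (intro integral_cong_AE) (auto elim!: eventually_mono)
  then have "ereal c = ereal (c - 1 / (1 - \<delta>) * (\<integral>x. max 0 (c - Y x) \<partial>M))" by simp
  then show ?thesis
    unfolding cvar_def using True by (simp del: times_divide_eq_left) (rule SUP_upper2[of c]; simp)
next
  case False
  have "esssup M (\<lambda>x. - ereal (Y x)) \<le> - ereal c"
    using assms by (intro esssup_I) (auto elim!: eventually_mono)
  then show ?thesis
    using False by (simp add: cvar_def) (metis ereal_minus_le_minus ereal_uminus_uminus uminus_ereal.simps(1))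
qed

text \<open>A larger loss factor \<open>1 / (1 - \<delta>)\<close> may be replaced by a smaller one, since the shortfall
  is nonnegative; at level \<open>1\<close> any factor will do, since the shortfall vanishes.\<close>

lemma cvar_gtD:
  assumes "prob_space M" "Y \<in> borel_measurable M" "ereal c < cvar \<delta> M Y"
    and "\<delta> < 1 \<Longrightarrow> K \<le> 1 / (1 - \<delta>)"
  shows "\<exists>t. c < t - K * (\<integral>x. max 0 (t - Y x) \<partial>M)"
proof (cases "\<delta> < 1")
  case True
  then obtain t where "c < t - 1 / (1 - \<delta>) * (\<integral>x. max 0 (t - Y x) \<partial>M)"
    using assms(3) by (auto simp: cvar_def less_SUP_iff simp del: times_divide_eq_left)
  also have "\<dots> \<le> t - K * (\<integral>x. max 0 (t - Y x) \<partial>M)"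
    using assms(4)[OF True] by (intro diff_left_mono mult_right_mono) auto
  finally show ?thesis by blast
next
  case False
  then have "ereal c < - esssup M (\<lambda>x. - ereal (Y x))"
    using assms(3) by (simp add: cvar_def)
  then obtain t where t: "c < t" "ereal t < - esssup M (\<lambda>x. - ereal (Y x))"
    using ereal_dense2 by fastforce
  have "AE x in M. - ereal (Y x) \<le> esssup M (\<lambda>x. - ereal (Y x))"
    using assms(2) by (intro esssup_AE)
  then have AE: "AE x in M. t \<le> Y x"
  proof eventually_elim
    case (elim x)
    then have "ereal t < ereal (Y x)"
      using t(2) by (metis ereal_minus_le_minus ereal_uminus_uminus less_le_trans)
    then show ?case by simp
  qed
  have "(\<integral>x. max 0 (t - Y x) \<partial>M) = (\<integral>x. 0 \<partial>M)"
    using assms(2) AE by (intro integral_cong_AE) (auto elim!: eventually_mono)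
  then show ?thesis using t(1) by (intro exI[of _ t]) simp
qed

section \<open>The lower bound at every level, and its consequences\<close>

lemma r_lower_le_optimal_cvar_ratio:
  assumes \<delta>: "0 \<le> \<delta>" "\<delta> \<le> 1" and LU: "0 < L" "L \<le> U"
  shows "ereal (r_lower (U / L) \<delta>) \<le> optimal_cvar_ratio L U \<delta>"
  unfolding optimal_cvar_ratio_def
proof (rule INF_greatest, rule ccontr)
  fix \<mu> assume \<mu>: "\<mu> \<in> threshold_algorithms L U"
  assume "\<not> ereal (r_lower (U / L) \<delta>) \<le> cvar_ratio L U \<delta> \<mu>"
  then obtain \<beta> where \<beta>: "cvar_ratio L U \<delta> \<mu> < ereal \<beta>" "\<beta> < r_lower (U / L) \<delta>"
    using ereal_dense2 by (metis less_ereal.simps(1) not_le)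
  interpret prob_space \<mu> using threshold_algorithmsD(1)[OF \<mu>] .
  note [measurable_cong] = threshold_algorithmsD(2)[OF \<mu>]
  have meas: "threshold_profit L v \<in> borel_measurable \<mu>" for v by measurable
  have \<theta>: "1 \<le> U / L" using LU by simp
  have cvar_pos: "0 < cvar \<delta> \<mu> (threshold_profit L v)" for v
    using AE_le_imp_cvar_ge[OF prob_space_axioms meas threshold_profit_ge[OF \<mu>]] LU
    by (metis ereal_less(2) less_le_trans)
  have ratio: "ereal v / cvar \<delta> \<mu> (threshold_profit L v) < ereal \<beta>" if "v \<in> {L..U}" for v
    using \<beta>(1) that unfolding cvar_ratio_def by (meson SUP_upper le_less_trans)
  have "0 < \<beta>"
  proof -
    have "0 \<le> ereal L / cvar \<delta> \<mu> (threshold_profit L L)"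
      using cvar_pos[of L] LU by (intro zero_le_divide_ereal) (auto intro: less_imp_le)
    also have "\<dots> < ereal \<beta>" using ratio LU by simp
    finally show ?thesis by simp
  qed
  have cvar_gt: "ereal (v / \<beta>) < cvar \<delta> \<mu> (threshold_profit L v)" if "v \<in> {L..U}" for v
    using ratio[OF that] cvar_pos[of v] \<open>0 < \<beta>\<close>
    by (cases "cvar \<delta> \<mu> (threshold_profit L v)") (auto simp: field_simps)
  \<comment> \<open>Weak inequalities are what survives the limit at level 0; they suffice, since
    the left-hand side grows strictly from \<open>\<beta>\<close> to \<open>r_lower\<close>.\<close>
  have "U / L - 1 \<le> r_lower_lhs \<delta> \<beta>" "1 \<le> \<beta>"
  proof (atomize(full), cases "\<delta> = 0")
    case False
    let ?n = "n_lower \<delta>"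
    \<comment> \<open>Equivalent to \<open>1 / (n + 1) \<le> \<delta>\<close>, which the ceiling in
      \<open>n_lower\<close> guarantees.\<close>
    have "1 + 1 / real ?n \<le> 1 / (1 - \<delta>)" if "\<delta> < 1"
    proof -
      have "1 / \<delta> \<le> 1 + real ?n" unfolding n_lower_def by linarith
      then show ?thesis
        using False \<delta> that n_lower_ge_1[of \<delta>] by (simp add: field_simps)
    qed
    then have "\<exists>t. v / \<beta> < t - (1 + 1 / real ?n) * (\<integral>x. max 0 (t - threshold_profit L v x) \<partial>\<mu>)"
      if "v \<in> {L..U}" for v
      using cvar_gtD[OF prob_space_axioms meas cvar_gt[OF that]] by blast
    note threshold_ratio_gt[OF \<mu> n_lower_ge_1 LU \<open>0 < \<beta>\<close> this]
    then show "U / L - 1 \<le> r_lower_lhs \<delta> \<beta> \<and> 1 \<le> \<beta>" using False by (simp add: r_lower_lhs_def)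
  next
    case True
    \<comment> \<open>Chosen so that \<open>v / b n = v / \<beta> - v / n\<close>: the extra loss
      from the factor \<open>1 + 1 / n\<close> is at most \<open>v / n\<close>.\<close>
    define b where "b n = 1 / (1 / \<beta> - 1 / real n)" for n
    have b: "b \<longlonglongrightarrow> \<beta>"
    proof -
      have "b \<longlonglongrightarrow> 1 / (1 / \<beta> - 0)"
        unfolding b_def using \<open>0 < \<beta>\<close> by (intro tendsto_intros lim_1_over_n) auto
      then show ?thesis by simp
    qed
    \<comment> \<open>At level 0 the objective is the mean of the profit capped at \<open>t\<close>;
      as the profit never exceeds \<open>v\<close>, the choice \<open>t = v\<close> is optimal. It
      also bounds the shortfall by \<open>v\<close>, which an arbitrary \<open>t\<close> would
      not.\<close>
    have shortfall: "v / \<beta> < v - (\<integral>x. max 0 (v - threshold_profit L v x) \<partial>\<mu>)" if v: "v \<in> {L..U}" for v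
    proof -
      obtain t where "v / \<beta> < t - (\<integral>x. max 0 (t - threshold_profit L v x) \<partial>\<mu>)"
        using cvar_gtD[OF prob_space_axioms meas cvar_gt[OF v], of 1] True by auto
      also have "\<dots> = (\<integral>x. t - max 0 (t - threshold_profit L v x) \<partial>\<mu>)"
        using integrable_shortfall[OF \<mu>] by (subst Bochner_Integration.integral_diff) (auto simp: prob_space)
      also have "\<dots> \<le> (\<integral>x. v - max 0 (v - threshold_profit L v x) \<partial>\<mu>)"
      proof (intro integral_mono Bochner_Integration.integrable_diff integrable_shortfall[OF \<mu>])
        show "t - max 0 (t - threshold_profit L v x) \<le> v - max 0 (v - threshold_profit L v x)" for x
          using v by (auto simp: threshold_profit_eq)
      qed auto
      also have "\<dots> = v - (\<integral>x. max 0 (v - threshold_profit L v x) \<partial>\<mu>)"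
        using integrable_shortfall[OF \<mu>] by (subst Bochner_Integration.integral_diff) (auto simp: prob_space)
      finally show ?thesis .
    qed
    have b_ge: "1 \<le> b n \<and> U / L - 1 \<le> (b n - 1) * exp (b n)" if n: "1 \<le> n" "\<beta> < n" for n
    proof -
      have "0 < b n" using n \<open>0 < \<beta>\<close> by (simp add: b_def field_simps)
      have "\<exists>t. v / b n < t - (1 + 1 / real n) * (\<integral>x. max 0 (t - threshold_profit L v x) \<partial>\<mu>)"
        if v: "v \<in> {L..U}" for v
      proof -
        let ?S = "\<integral>x. max 0 (v - threshold_profit L v x) \<partial>\<mu>"
        have "0 \<le> v / \<beta>" using v LU \<open>0 < \<beta>\<close> by simp
        then have "?S / n \<le> v / n"
          using shortfall[OF v] by (intro divide_right_mono) auto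
        then have "v / b n < v - (1 + 1 / real n) * ?S"
          using shortfall[OF v] by (simp add: b_def algebra_simps)
        then show ?thesis by blast
      qed
      note ratio = threshold_ratio_gt[OF \<mu> n(1) LU \<open>0 < b n\<close> this]
      have "(b n - 1) * (1 + b n / n) ^ n \<le> (b n - 1) * exp (b n)"
        using ratio(1) n(1) by (intro mult_left_mono exp_ge_one_plus_x_over_n_power_n) auto
      then show ?thesis using ratio by linarith
    qed
    have "\<forall>\<^sub>F n in sequentially. 1 \<le> n \<and> \<beta> < real n"
      using eventually_ge_at_top[of 1] eventually_gt_at_top[of "nat \<lceil>\<beta>\<rceil>"]
      by eventually_elim linarith
    then have "\<forall>\<^sub>F n in sequentially. 1 \<le> b n \<and> U / L - 1 \<le> (b n - 1) * exp (b n)"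
      by eventually_elim (rule b_ge; simp)
    then have "\<forall>\<^sub>F n in sequentially. 1 \<le> b n" "\<forall>\<^sub>F n in sequentially. U / L - 1 \<le> (b n - 1) * exp (b n)"
      by (simp_all add: eventually_conj_iff)
    moreover have "(\<lambda>n. (b n - 1) * exp (b n)) \<longlonglongrightarrow> (\<beta> - 1) * exp \<beta>"
      by (intro tendsto_intros b)
    ultimately have "1 \<le> \<beta>" "U / L - 1 \<le> (\<beta> - 1) * exp \<beta>"
      by (auto intro: tendsto_lowerbound b)
    then show "U / L - 1 \<le> r_lower_lhs \<delta> \<beta> \<and> 1 \<le> \<beta>"
      using True by (simp add: r_lower_lhs_def)
  qed
  then show False
    using r_lower_lhs_strict_mono[of \<beta> "r_lower (U / L) \<delta>" \<delta>] \<beta>(2) r_lower_works(2)[OF \<theta>, of \<delta>] by simp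
qed

theorem theorem7:
  fixes \<theta> :: real
  assumes "1 \<le> \<theta>"
  shows "(\<forall>\<delta>\<in>{0..1}.
            (\<exists>!r. 0 < r \<and> r_lower_lhs \<delta> r = \<theta> - 1) \<and>
            (\<forall>L U. 0 < L \<and> L \<le> U \<and> \<theta> = U / L \<longrightarrow>
               ereal (r_lower \<theta> \<delta>) \<le> optimal_cvar_ratio L U \<delta>)) \<and>
         (1 < \<theta> \<longrightarrow>
            (\<exists>c>0. \<forall>\<^sub>F \<delta> in at_right 0. \<forall>L U. 0 < L \<and> L \<le> U \<and> \<theta> = U / L \<longrightarrow>
               ereal (1 + lambert_W0 ((\<theta> - 1) / exp 1) + c * \<delta>) \<le> optimal_cvar_ratio L U \<delta>)) \<and>
         (\<forall>\<delta>\<in>{1/2..1}. \<forall>L U. 0 < L \<and> L \<le> U \<and> \<theta> = U / L \<longrightarrow>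
            ereal (sqrt \<theta>) \<le> optimal_cvar_ratio L U \<delta>)"
proof (intro conjI ballI impI allI)
  fix \<delta> :: real
  assume "\<delta> \<in> {0..1}"
  show "\<exists>!r. 0 < r \<and> r_lower_lhs \<delta> r = \<theta> - 1"
    using assms by (rule ex1_r_lower)
next
  fix \<delta> L U :: real
  assume "\<delta> \<in> {0..1}" "0 < L \<and> L \<le> U \<and> \<theta> = U / L"
  then show "ereal (r_lower \<theta> \<delta>) \<le> optimal_cvar_ratio L U \<delta>"
    by (simp add: r_lower_le_optimal_cvar_ratio)
next
  assume \<theta>: "1 < \<theta>"
  obtain c where c: "0 < c" "\<forall>\<^sub>F \<delta> in at_right 0. r_lower \<theta> 0 + c * \<delta> \<le> r_lower \<theta> \<delta>"
    using r_lower_first_order[OF \<theta>] by blast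
  have "\<forall>\<^sub>F \<delta> in at_right (0::real). 0 < \<delta> \<and> \<delta> < 1"
    using eventually_at_right_real[of 0 1] by (auto elim: eventually_mono)
  with c(2) have "\<forall>\<^sub>F \<delta> in at_right 0. \<forall>L U. 0 < L \<and> L \<le> U \<and> \<theta> = U / L \<longrightarrow>
      ereal (1 + lambert_W0 ((\<theta> - 1) / exp 1) + c * \<delta>) \<le> optimal_cvar_ratio L U \<delta>"
  proof eventually_elim
    case (elim \<delta>)
    show ?case
    proof (intro allI impI)
      fix L U assume LU: "0 < L \<and> L \<le> U \<and> \<theta> = U / L"
      have "ereal (1 + lambert_W0 ((\<theta> - 1) / exp 1) + c * \<delta>) \<le> ereal (r_lower \<theta> \<delta>)"
        using elim(1) lambert_W0_eq_r_lower[OF \<theta>] by simp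
      also have "\<dots> \<le> optimal_cvar_ratio L U \<delta>"
        using elim(2) LU by (simp add: r_lower_le_optimal_cvar_ratio)
      finally show "ereal (1 + lambert_W0 ((\<theta> - 1) / exp 1) + c * \<delta>) \<le> optimal_cvar_ratio L U \<delta>" .
    qed
  qed
  with c(1) show "\<exists>c>0. \<forall>\<^sub>F \<delta> in at_right 0. \<forall>L U. 0 < L \<and> L \<le> U \<and> \<theta> = U / L \<longrightarrow>
      ereal (1 + lambert_W0 ((\<theta> - 1) / exp 1) + c * \<delta>) \<le> optimal_cvar_ratio L U \<delta>"
    by blast
next
  fix \<delta> L U :: real
  assume \<delta>: "\<delta> \<in> {1/2..1}" and LU: "0 < L \<and> L \<le> U \<and> \<theta> = U / L"
  then show "ereal (sqrt \<theta>) \<le> optimal_cvar_ratio L U \<delta>"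
    using r_lower_le_optimal_cvar_ratio[of \<delta> L U] r_lower_half[OF assms, of \<delta>] by simp
qed

end
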